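(* Let $G$ be a finite group and let $T$ be a finite regular trisp with a $G$-action satisfying Condition R. Let $\phi:B\rightarrow R$ be a $G$-equivariant trisp closure map on $T$, where $B$ and $R$ are closed under $G$ (that is, $G\cdot B\cap G\cdot R=\emptyset$). Then the quotient map $\phi_G$, given by $\phi_G(Gb)=G\phi(b)$ for $b\in B$, with blue vertices $\{Gb : b\in B\}$ and red vertices $\{Gr : r\in R\}$, is a trisp closure map on $T/G$.
   Context: A trisp (triangulated space, $\Delta$-complex, semisimplicial set) $T$ consists of sets $S_n(T)$, $n\ge 0$, of $n$-simplices together with boundary maps $\partial_i:S_n(T)\to S_{n-1}(T)$, $0\le i\le n$, satisfying $\partial_i\partial_j=\partial_{j-1}\partial_i$ for $i<j$. Vertices are the $0$-simplices; every $n$-simplex has an ordered list of vertices $v_0,\dots,v_n$, and "minimal" refers to this order. The faces (boundary simplices) of $\sigma$ are those obtained by iterated boundary maps. $T$ is regular if each $n$-simplex has $n+1$ distinct vertices. A $G$-action on $T$ is an action on the sets of simplices commuting with all boundary maps (hence respecting vertex orders). Condition R: for any $g\in G$ and any simplex $\sigma$ of $T$, $g(\sigma)\cap\sigma$ is fixed pointwise by $g$, i.e. every simplex that is a face of both $\sigma$ and $g\sigma$ (each simplex counting as a face of itself) is fixed by $g$. The quotient $T/G$ is the trisp whose simplices are the orbits $G\sigma$, with $\partial_i(G\sigma)=G(\partial_i\sigma)$; Condition R guarantees that it is regular. A trisp closure map on a regular trisp $T$ is a partition of the vertex set into blue vertices $B$ and red vertices $R$, together with a map $\phi:B\to R$ such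 that for every simplex $\sigma$ of $T$ containing at least one blue vertex, with $b$ its minimal blue vertex, one of the following holds: either $\phi(b)$ is a vertex of $\sigma$, and removing $\phi(b)$ from $\sigma$ yields another (unique) simplex of $T$; or $\phi(b)$ is not a vertex of $\sigma$, and there exists a unique simplex $\tau$ of $T$ that contains $\phi(b)$ as a vertex and $\sigma$ as a boundary simplex of codimension $1$. The map $\phi$ is $G$-equivariant if $\phi(gb)=g\phi(b)$ for all $g\in G$, $b\in B$. *)

theory Defs
  imports "HOL-Algebra.Group_Action"
begin

text \<open>
  The \<open>n\<close>-simplices of a trisp are \<open>simplices T n\<close>; the sets for different \<open>n\<close> need not be
  disjoint, so a simplex is always given together with its dimension. The map
  \<open>bdry T n i\<close> is the boundary map \<open>\<partial>\<^sub>i\<close> from \<open>(n + 1)\<close>-simplices to \<open>n\<close>-simplices: its index is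
  the dimension of the target.
\<close>

record 'a trisp_data =
  simplices :: "nat \<Rightarrow> 'a set"
  bdry :: "nat \<Rightarrow> nat \<Rightarrow> 'a \<Rightarrow> 'a"

locale trisp =
  fixes T :: "'a trisp_data"
  assumes bdry_closed:
      "\<lbrakk>\<sigma> \<in> simplices T (Suc n); i \<le> Suc n\<rbrakk> \<Longrightarrow> bdry T n i \<sigma> \<in> simplices T n"
    and bdry_bdry:
      "\<lbrakk>\<sigma> \<in> simplices T (Suc (Suc n)); i < j; j \<le> Suc (Suc n)\<rbrakk> \<Longrightarrow>
         bdry T n i (bdry T (Suc n) j \<sigma>) = bdry T n (j - 1) (bdry T (Suc n) i \<sigma>)"

text \<open>
  \<open>vertex T n k \<sigma>\<close> is the vertex \<open>v\<^sub>k\<close> of the \<open>n\<close>-simplex \<open>\<sigma>\<close> (for \<open>k \<le> n\<close>), obtained by removing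
  all other vertices: \<open>\<partial>\<^sub>i\<close> removes \<open>v\<^sub>i\<close>, so \<open>v\<^sub>k\<close> survives the removal of the last vertex if it is
  not the last one, and otherwise it is the last vertex of \<open>\<partial>\<^sub>0 \<sigma>\<close>. The lemma \<open>vertex_bdry\<close> below
  confirms that \<open>\<partial>\<^sub>i\<close> deletes precisely the \<open>i\<close>-th entry of the list of vertices.
\<close>

primrec vertex :: "'a trisp_data \<Rightarrow> nat \<Rightarrow> nat \<Rightarrow> 'a \<Rightarrow> 'a" where
  "vertex T 0 k \<sigma> = \<sigma>"
| "vertex T (Suc n) k \<sigma> =
     (if k \<le> n then vertex T n k (bdry T n (Suc n) \<sigma>) else vertex T n n (bdry T n 0 \<sigma>))"

definition vertices :: "'a trisp_data \<Rightarrow> nat \<Rightarrow> 'a \<Rightarrow> 'a set" where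
  "vertices T n \<sigma> = {vertex T n k \<sigma> | k. k \<le> n}"

lemma (in trisp) vertex_bdry:
  assumes "\<sigma> \<in> simplices T (Suc n)" "i \<le> Suc n" "k \<le> n"
  shows "vertex T n k (bdry T n i \<sigma>) = vertex T (Suc n) (if k < i then k else Suc k) \<sigma>"
  using assms
proof (induction n arbitrary: \<sigma> i k)
  case 0
  then show ?case by (cases i) auto
next
  case (Suc n)
  have closed: "bdry T (Suc n) j \<sigma> \<in> simplices T (Suc n)" if "j \<le> Suc (Suc n)" for j
    using bdry_closed Suc.prems(1) that by blast
  note comm = bdry_bdry[OF Suc.prems(1)]
  note IH = Suc.IH[OF closed]
  show ?case
  proof (cases "k \<le> n")
    case True
    show ?thesis
    proof (cases "i \<le> Suc n")
      case i: True
      have "vertex T (Suc n) k (bdry T (Suc n) i \<sigma>)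
              = vertex T n k (bdry T n (Suc n) (bdry T (Suc n) i \<sigma>))"
        using True by simp
      also have "\<dots> = vertex T n k (bdry T n i (bdry T (Suc n) (Suc (Suc n)) \<sigma>))"
        using comm[of i "Suc (Suc n)"] i by simp
      also have "\<dots> = vertex T (Suc n) (if k < i then k else Suc k)
                        (bdry T (Suc n) (Suc (Suc n)) \<sigma>)"
        using IH[of "Suc (Suc n)" i k] i True by simp
      finally show ?thesis using True by (auto simp del: vertex.simps simp: vertex.simps(2)[of T "Suc n"])
    next
      case False
      then have "i = Suc (Suc n)" using Suc.prems by simp
      then show ?thesis using True by simp
    qed
  next
    case False
    then have k: "k = Suc n" using Suc.prems by simp
    show ?thesis
    proof (cases "i = 0")
      case True
      then show ?thesis using k by simp
    next
      case False
      have "vertex T (Suc n) k (bdry T (Suc n) i \<sigma>) = vertex T n n (bdry T n 0 (bdry T (Suc n) i \<sigma>))"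
        using k by simp
      also have "\<dots> = vertex T n n (bdry T n (i - 1) (bdry T (Suc n) 0 \<sigma>))"
        using comm[of 0 i] False Suc.prems by simp
      also have "\<dots> = vertex T (Suc n) (if n < i - 1 then n else Suc n) (bdry T (Suc n) 0 \<sigma>)"
        using IH[of 0 "i - 1" n] Suc.prems by simp
      also have "\<dots> = vertex T (Suc (Suc n)) (if k < i then k else Suc k) \<sigma>"
      proof (cases "i = Suc (Suc n)")
        case True
        have "vertex T (Suc n) n (bdry T (Suc n) 0 \<sigma>) =
                vertex T n n (bdry T n (Suc n) (bdry T (Suc n) 0 \<sigma>))"
          by simp
        also have "\<dots> = vertex T n n (bdry T n 0 (bdry T (Suc n) (Suc (Suc n)) \<sigma>))"
          using comm[of 0 "Suc (Suc n)"] by simp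
        also have "\<dots> = vertex T (Suc (Suc n)) (Suc n) \<sigma>"
          by simp
        finally show ?thesis using True k by simp
      next
        case False
        then have "\<not> n < i - 1" "\<not> k < i" using Suc.prems k by auto
        then show ?thesis using k by simp
      qed
      finally show ?thesis .
    qed
  qed
qed

locale regular_trisp = trisp T for T :: "'a trisp_data" +
  assumes distinct_vertices:
    "\<sigma> \<in> simplices T n \<Longrightarrow> inj_on (\<lambda>k. vertex T n k \<sigma>) {..n}"

text \<open>\<open>is_face T m \<rho> n \<sigma>\<close>: the \<open>m\<close>-simplex \<open>\<rho>\<close> is a face of the \<open>n\<close>-simplex \<open>\<sigma>\<close>.\<close>

inductive is_face :: "'a trisp_data \<Rightarrow> nat \<Rightarrow> 'a \<Rightarrow> nat \<Rightarrow> 'a \<Rightarrow> bool" for T where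
  face_refl: "is_face T n \<sigma> n \<sigma>"
| face_bdry: "\<lbrakk>is_face T (Suc m) \<rho> n \<sigma>; i \<le> Suc m\<rbrakk> \<Longrightarrow> is_face T m (bdry T m i \<rho>) n \<sigma>"

definition finite_trisp :: "'a trisp_data \<Rightarrow> bool" where
  "finite_trisp T \<longleftrightarrow> finite (SIGMA n:UNIV. simplices T n)"

text \<open>\<open>act n g\<close> is the action of \<open>g\<close> on the \<open>n\<close>-simplices.\<close>

locale trisp_action = trisp T + group G
  for G :: "('g, 'm) monoid_scheme" (structure)
    and act :: "nat \<Rightarrow> 'g \<Rightarrow> 'a \<Rightarrow> 'a"
    and T :: "'a trisp_data" +
  assumes action: "group_action G (simplices T n) (act n)"
    and act_bdry:
      "\<lbrakk>g \<in> carrier G; \<sigma> \<in> simplices T (Suc n); i \<le> Suc n\<rbrakk> \<Longrightarrow>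
         act n g (bdry T n i \<sigma>) = bdry T n i (act (Suc n) g \<sigma>)"

definition condition_R ::
    "('g, 'm) monoid_scheme \<Rightarrow> (nat \<Rightarrow> 'g \<Rightarrow> 'a \<Rightarrow> 'a) \<Rightarrow> 'a trisp_data \<Rightarrow> bool" where
  "condition_R G act T \<longleftrightarrow>
     (\<forall>g\<in>carrier G. \<forall>n. \<forall>\<sigma>\<in>simplices T n. \<forall>m \<rho>.
        is_face T m \<rho> n \<sigma> \<and> is_face T m \<rho> n (act n g \<sigma>) \<longrightarrow> act m g \<rho> = \<rho>)"

text \<open>
  The boundary map of the quotient is computed on a chosen representative; by the lemma
  \<open>bdry_quotient_trisp\<close> below the choice does not matter.
\<close>

definition quotient_trisp ::
    "('g, 'm) monoid_scheme \<Rightarrow> (nat \<Rightarrow> 'g \<Rightarrow> 'a \<Rightarrow> 'a) \<Rightarrow> 'a trisp_data \<Rightarrow> 'a set trisp_data" where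
  "quotient_trisp G act T =
     \<lparr>simplices = (\<lambda>n. orbits G (simplices T n) (act n)),
      bdry = (\<lambda>n i Q. orbit G (act n) (bdry T n i (SOME \<sigma>. \<sigma> \<in> Q)))\<rparr>"

lemma (in trisp_action) bdry_quotient_trisp:
  assumes \<sigma>: "\<sigma> \<in> simplices T (Suc n)" and i: "i \<le> Suc n"
  shows "bdry (quotient_trisp G act T) n i (orbit G (act (Suc n)) \<sigma>)
           = orbit G (act n) (bdry T n i \<sigma>)"
proof -
  interpret A: group_action G "simplices T k" "act k" for k by (rule action)
  define \<sigma>' where "\<sigma>' = (SOME \<tau>. \<tau> \<in> orbit G (act (Suc n)) \<sigma>)"
  have "\<sigma>' \<in> orbit G (act (Suc n)) \<sigma>"
    unfolding \<sigma>'_def using A.orbit_refl[OF \<sigma>] by (rule someI)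
  then obtain g where g: "g \<in> carrier G" "\<sigma>' = act (Suc n) g \<sigma>"
    unfolding orbit_def by blast
  have d: "bdry T n i \<sigma> \<in> simplices T n" using bdry_closed[OF \<sigma> i] .
  have eq: "bdry T n i \<sigma>' = act n g (bdry T n i \<sigma>)"
    using act_bdry[OF g(1) \<sigma> i] g(2) by simp
  have d': "bdry T n i \<sigma>' \<in> simplices T n"
    using A.element_image[OF g(1) d eq[symmetric]] .
  have *: "bdry T n i \<sigma>' \<in> orbit G (act n) (bdry T n i \<sigma>)"
    unfolding orbit_def using g(1) eq by auto
  have **: "bdry T n i \<sigma> \<in> orbit G (act n) (bdry T n i \<sigma>')"
    using A.orbit_sym[OF d d' *] .
  have sub: "orbit G (act n) \<rho> \<subseteq> simplices T n" if "\<rho> \<in> simplices T n" for \<rho>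
    unfolding orbit_def using A.element_image[OF _ that refl] by auto
  have "orbit G (act n) (bdry T n i \<sigma>') = orbit G (act n) (bdry T n i \<sigma>)"
  proof (intro subset_antisym subsetI)
    fix z assume z: "z \<in> orbit G (act n) (bdry T n i \<sigma>')"
    then have "z \<in> simplices T n" using sub[OF d'] by (rule rev_subsetD)
    then show "z \<in> orbit G (act n) (bdry T n i \<sigma>)" using A.orbit_trans[OF d d' _ * z] by simp
  next
    fix z assume z: "z \<in> orbit G (act n) (bdry T n i \<sigma>)"
    then have "z \<in> simplices T n" using sub[OF d] by (rule rev_subsetD)
    then show "z \<in> orbit G (act n) (bdry T n i \<sigma>')" using A.orbit_trans[OF d' d _ ** z] by simp
  qed
  then show ?thesis by (simp add: quotient_trisp_def \<sigma>'_def)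
qed

definition is_min_blue :: "'a trisp_data \<Rightarrow> 'a set \<Rightarrow> nat \<Rightarrow> 'a \<Rightarrow> 'a \<Rightarrow> bool" where
  "is_min_blue T B n \<sigma> b \<longleftrightarrow>
     (\<exists>k\<le>n. b = vertex T n k \<sigma> \<and> b \<in> B \<and> (\<forall>j<k. vertex T n j \<sigma> \<notin> B))"

locale trisp_closure_map = regular_trisp T
  for T :: "'a trisp_data" and B R :: "'a set" and \<phi> :: "'a \<Rightarrow> 'a" +
  assumes partition: "B \<union> R = simplices T 0" "B \<inter> R = {}"
    and maps: "\<phi> \<in> B \<rightarrow> R"
    and closure: "\<lbrakk>\<sigma> \<in> simplices T n; is_min_blue T B n \<sigma> b\<rbrakk> \<Longrightarrow>
      (\<phi> b \<in> vertices T n \<sigma> \<and>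
        (\<exists>m. n = Suc m \<and>
          (\<exists>!\<tau>. \<tau> \<in> simplices T m \<and>
            (\<exists>i\<le>Suc m. vertex T (Suc m) i \<sigma> = \<phi> b \<and> bdry T m i \<sigma> = \<tau>)))) \<or>
      (\<phi> b \<notin> vertices T n \<sigma> \<and>
        (\<exists>!\<tau>. \<tau> \<in> simplices T (Suc n) \<and> \<phi> b \<in> vertices T (Suc n) \<tau> \<and>
          (\<exists>i\<le>Suc n. bdry T n i \<tau> = \<sigma>)))"

text \<open>
  As for the boundary maps, \<open>\<phi>\<^sub>G\<close> is computed on a chosen representative; for equivariant \<open>\<phi>\<close>
  the defining equation \<open>\<phi>\<^sub>G (G b) = G (\<phi> b)\<close> has to be proved.
\<close>

definition quotient_map ::
    "('g, 'm) monoid_scheme \<Rightarrow> (nat \<Rightarrow> 'g \<Rightarrow> 'a \<Rightarrow> 'a) \<Rightarrow> ('a \<Rightarrow> 'a) \<Rightarrow> 'a set \<Rightarrow> 'a set" where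
  "quotient_map G act \<phi> Q = orbit G (act 0) (\<phi> (SOME b. b \<in> Q))"

end

theory Submission
  imports Defs
begin

text \<open>
  Vertices, faces and the colours of vertices all pass to orbits, so a simplex \<open>G \<sigma>\<close> of the
  quotient has minimal blue vertex \<open>G b\<close> for the minimal blue vertex \<open>b\<close> of \<open>\<sigma>\<close>, and existence of
  the required simplices is inherited from \<open>T\<close>. Condition R enters through one consequence: two
  different vertices of a simplex are never in the same orbit
  (\<open>same_orbit_vertices_eq\<close>). This makes the quotient regular, and it also gives
  uniqueness of the simplex over \<open>G \<sigma>\<close>, as follows.

  Suppose that \<open>G \<phi>(b)\<close> is not a vertex of \<open>G \<sigma>\<close>. A simplex of the quotient that contains
  \<open>G \<phi>(b)\<close> and has \<open>G \<sigma>\<close> as a facet is the orbit of some \<open>\<tau>\<close> with facet \<open>\<sigma>\<close>, whose additional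
  vertex is \<open>g \<phi>(b)\<close> for some \<open>g\<close>. This vertex is red, so \<open>b\<close> is still the minimal blue vertex of
  \<open>\<tau>\<close>. If \<open>\<phi>(b)\<close> were not a vertex of \<open>\<tau>\<close>, then the closure map would supply a simplex over \<open>\<tau>\<close>
  with the two different vertices \<open>\<phi>(b)\<close> and \<open>g \<phi>(b)\<close> in the same orbit. Hence \<open>\<phi>(b)\<close> is a vertex
  of \<open>\<tau>\<close>, and \<open>\<tau>\<close> is the simplex that \<open>\<phi>\<close> assigns to \<open>\<sigma>\<close> (\<open>red_coface_contains_image\<close>).
\<close>

section \<open>Vertices and faces\<close>

context trisp
begin

lemma vertex_closed:
  "\<lbrakk>\<sigma> \<in> simplices T n; k \<le> n\<rbrakk> \<Longrightarrow> vertex T n k \<sigma> \<in> simplices T 0"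
  by (induction n arbitrary: \<sigma> k) (auto simp: bdry_closed)

lemma vertices_bdry_subset:
  assumes \<sigma>: "\<sigma> \<in> simplices T (Suc n)" and i: "i \<le> Suc n"
  shows "vertices T n (bdry T n i \<sigma>) \<subseteq> vertices T (Suc n) \<sigma>"
proof
  fix v assume "v \<in> vertices T n (bdry T n i \<sigma>)"
  then obtain k where k: "k \<le> n" "v = vertex T n k (bdry T n i \<sigma>)"
    unfolding vertices_def by blast
  have "v = vertex T (Suc n) (if k < i then k else Suc k) \<sigma>"
    using vertex_bdry[OF \<sigma> i k(1)] k(2) by simp
  moreover have "(if k < i then k else Suc k) \<le> Suc n" using k(1) by simp
  ultimately show "v \<in> vertices T (Suc n) \<sigma>" unfolding vertices_def by blast
qed

lemma other_vertex_in_facet: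
  assumes \<sigma>: "\<sigma> \<in> simplices T (Suc n)" and i: "i \<le> Suc n" and j: "j \<le> Suc n" "j \<noteq> i"
  shows "vertex T (Suc n) j \<sigma> \<in> vertices T n (bdry T n i \<sigma>)"
proof -
  define k where "k = (if j < i then j else j - 1)"
  have k: "k \<le> n" "(if k < i then k else Suc k) = j"
    using i j by (auto simp: k_def)
  have "vertex T n k (bdry T n i \<sigma>) = vertex T (Suc n) j \<sigma>"
    using vertex_bdry[OF \<sigma> i k(1)] k(2) by simp
  then show ?thesis using k(1) unfolding vertices_def by (metis (mono_tags, lifting) mem_Collect_eq)
qed

lemma vertex_of_face_is_face:
  "\<lbrakk>is_face T m \<rho> n \<sigma>; k \<le> m\<rbrakk> \<Longrightarrow> is_face T 0 (vertex T m k \<rho>) n \<sigma>"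
  by (induction m arbitrary: \<rho> k) (auto intro: face_bdry)

lemma vertex_is_face: "k \<le> n \<Longrightarrow> is_face T 0 (vertex T n k \<sigma>) n \<sigma>"
  by (rule vertex_of_face_is_face[OF face_refl])

text \<open>
  Deleting \<open>v\<^sub>i\<close> only shifts the positions of the later vertices, so the order of the blue
  vertices, and with it their minimum, survives when \<open>v\<^sub>i\<close> is not blue.
\<close>

lemma is_min_blue_coface:
  assumes \<tau>: "\<tau> \<in> simplices T (Suc n)" and i: "i \<le> Suc n"
    and not_blue: "vertex T (Suc n) i \<tau> \<notin> B"
    and min: "is_min_blue T B n (bdry T n i \<tau>) b"
  shows "is_min_blue T B (Suc n) \<tau> b"
proof -
  obtain k where k: "k \<le> n" "b = vertex T n k (bdry T n i \<tau>)" "b \<in> B"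
    and before: "\<And>j. j < k \<Longrightarrow> vertex T n j (bdry T n i \<tau>) \<notin> B"
    using min unfolding is_min_blue_def by blast
  define k' where "k' = (if k < i then k else Suc k)"
  have "vertex T (Suc n) j \<tau> \<notin> B" if j: "j < k'" for j
  proof (cases "j = i")
    case True
    then show ?thesis using not_blue by simp
  next
    case False
    define l where "l = (if j < i then j else j - 1)"
    have l: "l < k" "(if l < i then l else Suc l) = j"
      using j False by (auto simp: l_def k'_def split: if_splits)
    then show ?thesis
      using before[OF l(1)] vertex_bdry[OF \<tau> i, of l] k(1) by simp
  qed
  moreover have "b = vertex T (Suc n) k' \<tau>"
    using vertex_bdry[OF \<tau> i k(1)] k(2) by (simp add: k'_def)
  moreover have "k' \<le> Suc n" using k(1) by (simp add: k'_def)
  ultimately show ?thesis using k(3) unfolding is_min_blue_def by blast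
qed

end

section \<open>The quotient trisp\<close>

context trisp_action
begin

sublocale A: group_action G "simplices T n" "act n" for n
  by (rule action)

abbreviation Orb :: "nat \<Rightarrow> 'a \<Rightarrow> 'a set" where
  "Orb n \<sigma> \<equiv> orbit G (act n) \<sigma>"

abbreviation Q :: "'a set trisp_data" where
  "Q \<equiv> quotient_trisp G act T"

lemma act_closed: "\<lbrakk>g \<in> carrier G; \<sigma> \<in> simplices T n\<rbrakk> \<Longrightarrow> act n g \<sigma> \<in> simplices T n"
  by (rule A.element_image[OF _ _ refl])

lemma act_inj:
  "\<lbrakk>g \<in> carrier G; \<sigma> \<in> simplices T n; \<tau> \<in> simplices T n; act n g \<sigma> = act n g \<tau>\<rbrakk> \<Longrightarrow> \<sigma> = \<tau>"
  using A.inj_prop by (metis inj_onD)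

lemma orbit_act:
  assumes g: "g \<in> carrier G" and \<sigma>: "\<sigma> \<in> simplices T n"
  shows "Orb n (act n g \<sigma>) = Orb n \<sigma>"
proof (intro subset_antisym subsetI)
  fix z assume "z \<in> Orb n (act n g \<sigma>)"
  then obtain h where h: "h \<in> carrier G" "z = act n h (act n g \<sigma>)"
    unfolding orbit_def by blast
  then have "z = act n (h \<otimes> g) \<sigma>" using A.composition_rule[OF \<sigma> h(1) g] by simp
  then show "z \<in> Orb n \<sigma>" using g h(1) unfolding orbit_def by blast
next
  fix z assume "z \<in> Orb n \<sigma>"
  then obtain h where h: "h \<in> carrier G" "z = act n h \<sigma>"
    unfolding orbit_def by blast
  have "z = act n (h \<otimes> inv g) (act n g \<sigma>)"
    using A.composition_rule[OF act_closed[OF g \<sigma>] h(1), of "inv g"] A.orbit_sym_aux[OF g \<sigma> refl] g h(2)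
    by simp
  then show "z \<in> Orb n (act n g \<sigma>)" using g h(1) unfolding orbit_def by blast
qed

lemma orbit_eqE:
  assumes "Orb n \<sigma> = Orb n \<tau>" and "\<tau> \<in> simplices T n"
  obtains g where "g \<in> carrier G" "\<tau> = act n g \<sigma>"
proof -
  have "\<tau> \<in> Orb n \<sigma>" using A.orbit_refl[OF assms(2)] assms(1) by simp
  then show ?thesis using that unfolding orbit_def by blast
qed

lemma simplices_quotient: "simplices Q n = {Orb n \<sigma> | \<sigma>. \<sigma> \<in> simplices T n}"
  by (auto simp: quotient_trisp_def orbits_def)

lemma act_vertex:
  "\<lbrakk>g \<in> carrier G; \<sigma> \<in> simplices T n; k \<le> n\<rbrakk> \<Longrightarrow>
     act 0 g (vertex T n k \<sigma>) = vertex T n k (act n g \<sigma>)"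
  by (induction n arbitrary: \<sigma> k) (auto simp: act_bdry bdry_closed)

lemma vertex_quotient:
  "\<lbrakk>\<sigma> \<in> simplices T n; k \<le> n\<rbrakk> \<Longrightarrow> vertex Q n k (Orb n \<sigma>) = Orb 0 (vertex T n k \<sigma>)"
  by (induction n arbitrary: \<sigma> k) (auto simp: bdry_quotient_trisp bdry_closed)

lemma vertices_quotient:
  "\<sigma> \<in> simplices T n \<Longrightarrow> vertices Q n (Orb n \<sigma>) = Orb 0 ` vertices T n \<sigma>"
  unfolding vertices_def by (auto simp: vertex_quotient) (metis vertex_quotient)

lemma trisp_quotient: "trisp Q"
proof
  fix \<sigma> n i assume "\<sigma> \<in> simplices Q (Suc n)" "i \<le> Suc n"
  then show "bdry Q n i \<sigma> \<in> simplices Q n"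
    by (auto simp: simplices_quotient bdry_quotient_trisp intro: bdry_closed)
next
  fix \<sigma> n i j assume "\<sigma> \<in> simplices Q (Suc (Suc n))" "i < j" "j \<le> Suc (Suc n)"
  then show "bdry Q n i (bdry Q (Suc n) j \<sigma>) = bdry Q n (j - 1) (bdry Q (Suc n) i \<sigma>)"
    by (auto simp: simplices_quotient bdry_quotient_trisp bdry_closed bdry_bdry)
qed

text \<open>
  A facet relation between orbits is realised by any prescribed representative of the facet:
  translate a representative of the larger simplex.
\<close>

lemma coface_representative:
  assumes \<sigma>: "\<sigma> \<in> simplices T n" and \<tau>: "\<tau> \<in> simplices Q (Suc n)"
    and i: "i \<le> Suc n" and facet: "bdry Q n i \<tau> = Orb n \<sigma>"
  obtains \<tau>' where "\<tau>' \<in> simplices T (Suc n)" "\<tau> = Orb (Suc n) \<tau>'" "bdry T n i \<tau>' = \<sigma>"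
proof -
  obtain \<rho> where \<rho>: "\<rho> \<in> simplices T (Suc n)" "\<tau> = Orb (Suc n) \<rho>"
    using \<tau> unfolding simplices_quotient by blast
  have "Orb n (bdry T n i \<rho>) = Orb n \<sigma>"
    using facet bdry_quotient_trisp[OF \<rho>(1) i] \<rho>(2) by simp
  then obtain g where g: "g \<in> carrier G" "\<sigma> = act n g (bdry T n i \<rho>)"
    using \<sigma> by (rule orbit_eqE)
  show thesis
  proof
    show "act (Suc n) g \<rho> \<in> simplices T (Suc n)" using act_closed[OF g(1) \<rho>(1)] .
    show "\<tau> = Orb (Suc n) (act (Suc n) g \<rho>)" using orbit_act[OF g(1) \<rho>(1)] \<rho>(2) by simp
    show "bdry T n i (act (Suc n) g \<rho>) = \<sigma>" using act_bdry[OF g(1) \<rho>(1) i] g(2) by simp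
  qed
qed

text \<open>
  If \<open>w = g v\<close> for vertices \<open>v\<close>, \<open>w\<close> of \<open>\<sigma>\<close>, then \<open>w\<close> is a common vertex of \<open>\<sigma>\<close> and \<open>g \<sigma>\<close>, so
  \<open>g w = w = g v\<close>.
\<close>

lemma same_orbit_vertices_eq:
  assumes R: "condition_R G act T" and \<sigma>: "\<sigma> \<in> simplices T n"
    and vw: "v \<in> vertices T n \<sigma>" "w \<in> vertices T n \<sigma>"
    and orb: "Orb 0 v = Orb 0 w"
  shows "v = w"
proof -
  obtain j k where jk: "j \<le> n" "v = vertex T n j \<sigma>" "k \<le> n" "w = vertex T n k \<sigma>"
    using vw unfolding vertices_def by blast
  have v: "v \<in> simplices T 0" and w: "w \<in> simplices T 0"
    using vertex_closed[OF \<sigma>] jk by auto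
  obtain g where g: "g \<in> carrier G" "w = act 0 g v"
    using orbit_eqE[OF orb w] by blast
  have "w = vertex T n j (act n g \<sigma>)" using act_vertex[OF g(1) \<sigma> jk(1)] g(2) jk(2) by simp
  then have "is_face T 0 w n (act n g \<sigma>)" using vertex_is_face[OF jk(1)] by simp
  moreover have "is_face T 0 w n \<sigma>" using vertex_is_face[OF jk(3)] jk(4) by simp
  ultimately have "act 0 g w = w" using R g(1) \<sigma> unfolding condition_R_def by blast
  then show ?thesis using act_inj[OF g(1) v w] g(2) by simp
qed

lemma regular_quotient:
  assumes "condition_R G act T" and "regular_trisp T"
  shows "regular_trisp Q"
proof -
  interpret quotient: trisp Q by (rule trisp_quotient)
  show ?thesis
  proof
    fix \<sigma> n assume "\<sigma> \<in> simplices Q n"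
    then obtain \<rho> where \<rho>: "\<rho> \<in> simplices T n" "\<sigma> = Orb n \<rho>"
      unfolding simplices_quotient by blast
    show "inj_on (\<lambda>k. vertex Q n k \<sigma>) {..n}"
    proof (rule inj_onI)
      fix j k assume jk: "j \<in> {..n}" "k \<in> {..n}" and "vertex Q n j \<sigma> = vertex Q n k \<sigma>"
      then have "Orb 0 (vertex T n j \<rho>) = Orb 0 (vertex T n k \<rho>)"
        using \<rho> by (simp add: vertex_quotient)
      moreover have "vertex T n j \<rho> \<in> vertices T n \<rho>" "vertex T n k \<rho> \<in> vertices T n \<rho>"
        using jk unfolding vertices_def by auto
      ultimately have "vertex T n j \<rho> = vertex T n k \<rho>"
        using same_orbit_vertices_eq[OF assms(1) \<rho>(1)] by blast
      then show "j = k"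
        using regular_trisp.distinct_vertices[OF assms(2) \<rho>(1)] jk by (auto dest: inj_onD)
    qed
  qed
qed

lemma blue_orbit_iff:
  assumes "B \<subseteq> simplices T 0" and "\<And>g b. \<lbrakk>g \<in> carrier G; b \<in> B\<rbrakk> \<Longrightarrow> act 0 g b \<in> B"
    and "v \<in> simplices T 0"
  shows "Orb 0 v \<in> {Orb 0 b | b. b \<in> B} \<longleftrightarrow> v \<in> B"
proof
  assume "Orb 0 v \<in> {Orb 0 b | b. b \<in> B}"
  then obtain b where "b \<in> B" "Orb 0 b = Orb 0 v" by auto
  then show "v \<in> B" using assms(2) orbit_eqE[OF _ assms(3)] by metis
qed blast

lemma is_min_blue_quotient:
  assumes B: "B \<subseteq> simplices T 0" "\<And>g b. \<lbrakk>g \<in> carrier G; b \<in> B\<rbrakk> \<Longrightarrow> act 0 g b \<in> B"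
    and \<sigma>: "\<sigma> \<in> simplices T n"
    and min: "is_min_blue Q {Orb 0 b | b. b \<in> B} n (Orb n \<sigma>) c"
  shows "\<exists>b. is_min_blue T B n \<sigma> b \<and> c = Orb 0 b"
proof -
  obtain k where k: "k \<le> n" "c = vertex Q n k (Orb n \<sigma>)" "c \<in> {Orb 0 b | b. b \<in> B}"
    and before: "\<And>j. j < k \<Longrightarrow> vertex Q n j (Orb n \<sigma>) \<notin> {Orb 0 b | b. b \<in> B}"
    using min unfolding is_min_blue_def by blast
  have blue: "vertex Q n j (Orb n \<sigma>) \<in> {Orb 0 b | b. b \<in> B} \<longleftrightarrow> vertex T n j \<sigma> \<in> B"
    if "j \<le> n" for j
    unfolding vertex_quotient[OF \<sigma> that] by (rule blue_orbit_iff[OF B vertex_closed[OF \<sigma> that]])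
  have "vertex T n j \<sigma> \<notin> B" if "j < k" for j
    using before[OF that] blue[OF less_imp_le[OF less_le_trans[OF that k(1)]]] by blast
  moreover have "vertex T n k \<sigma> \<in> B" using k blue by blast
  ultimately have "is_min_blue T B n \<sigma> (vertex T n k \<sigma>)"
    using k(1) unfolding is_min_blue_def by blast
  then show ?thesis using k(2) vertex_quotient[OF \<sigma> k(1)] by blast
qed

lemma quotient_map_orbit:
  assumes "B \<subseteq> simplices T 0" and "\<phi> ` B \<subseteq> simplices T 0" and b: "b \<in> B"
    and equivariant: "\<And>g b. \<lbrakk>g \<in> carrier G; b \<in> B\<rbrakk> \<Longrightarrow> \<phi> (act 0 g b) = act 0 g (\<phi> b)"
  shows "quotient_map G act \<phi> (Orb 0 b) = Orb 0 (\<phi> b)"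
proof -
  have "b \<in> Orb 0 b" using A.orbit_refl assms(1) b by blast
  then have "(SOME c. c \<in> Orb 0 b) \<in> Orb 0 b" by (rule someI)
  then obtain g where g: "g \<in> carrier G" "(SOME c. c \<in> Orb 0 b) = act 0 g b"
    unfolding orbit_def by blast
  have "quotient_map G act \<phi> (Orb 0 b) = Orb 0 (act 0 g (\<phi> b))"
    unfolding quotient_map_def g(2) equivariant[OF g(1) b] ..
  also have "\<dots> = Orb 0 (\<phi> b)" using orbit_act[OF g(1)] assms(2) b by blast
  finally show ?thesis .
qed

text \<open>
  The additional vertex of \<open>\<tau>\<close> is a translate of \<open>\<phi>(b)\<close>, hence red, so \<open>b\<close> is the minimal blue
  vertex of \<open>\<tau>\<close> too. Were \<open>\<phi>(b)\<close> missing from \<open>\<tau>\<close>, it could be added to \<open>\<tau>\<close>; the result would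
  contain both \<open>\<phi>(b)\<close> and its translate. So a facet relation that involves \<open>\<phi>(b)\<close> only up to the
  action involves \<open>\<phi>(b)\<close> itself, and uniqueness in \<open>T\<close> becomes uniqueness in the quotient.
\<close>

lemma red_coface_contains_image:
  assumes R: "condition_R G act T" and closure_map: "trisp_closure_map T B R \<phi>"
    and R_closed: "\<And>g r. \<lbrakk>g \<in> carrier G; r \<in> R\<rbrakk> \<Longrightarrow> act 0 g r \<in> R"
    and \<tau>: "\<tau> \<in> simplices T (Suc n)" and i: "i \<le> Suc n"
    and min: "is_min_blue T B n (bdry T n i \<tau>) b"
    and new: "Orb 0 (\<phi> b) \<notin> Orb 0 ` vertices T n (bdry T n i \<tau>)"
    and orb: "Orb 0 (\<phi> b) \<in> Orb 0 ` vertices T (Suc n) \<tau>"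
  shows "\<phi> b \<in> vertices T (Suc n) \<tau>"
proof (rule ccontr)
  assume missing: "\<phi> b \<notin> vertices T (Suc n) \<tau>"
  interpret C: trisp_closure_map T B R \<phi> by (rule closure_map)
  obtain j where j: "j \<le> Suc n" "Orb 0 (\<phi> b) = Orb 0 (vertex T (Suc n) j \<tau>)"
    using orb unfolding vertices_def by auto
  have "j = i" using other_vertex_in_facet[OF \<tau> i j(1)] new j(2) by blast
  have vj: "vertex T (Suc n) j \<tau> \<in> simplices T 0" using vertex_closed[OF \<tau> j(1)] .
  obtain g where g: "g \<in> carrier G" "vertex T (Suc n) j \<tau> = act 0 g (\<phi> b)"
    using orbit_eqE[OF j(2) vj] by blast
  have "b \<in> B" using min unfolding is_min_blue_def by blast
  then have "vertex T (Suc n) j \<tau> \<in> R" using C.maps R_closed g by auto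
  then have "vertex T (Suc n) i \<tau> \<notin> B" using C.partition(2) \<open>j = i\<close> by blast
  then have "is_min_blue T B (Suc n) \<tau> b" using is_min_blue_coface[OF \<tau> i _ min] by blast
  then obtain \<rho> l where \<rho>: "\<rho> \<in> simplices T (Suc (Suc n))" "\<phi> b \<in> vertices T (Suc (Suc n)) \<rho>"
    and l: "l \<le> Suc (Suc n)" "bdry T (Suc n) l \<rho> = \<tau>"
    using C.closure[OF \<tau>] missing by blast
  have in_\<tau>: "vertex T (Suc n) j \<tau> \<in> vertices T (Suc n) \<tau>" using j(1) unfolding vertices_def by blast
  then have "vertex T (Suc n) j \<tau> \<in> vertices T (Suc (Suc n)) \<rho>"
    using vertices_bdry_subset[OF \<rho>(1) l(1)] l(2) by blast
  then have "\<phi> b = vertex T (Suc n) j \<tau>"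
    using same_orbit_vertices_eq[OF R \<rho>(1) \<rho>(2) _ j(2)] by blast
  then show False using missing in_\<tau> by simp
qed

end

section \<open>The closure map on the quotient\<close>

text \<open>
  The first alternative for a closure map holds for free: a vertex of a regular trisp occupies a
  single position in its simplex, so only one facet arises by removing it, and \<open>r \<noteq> b\<close> forces
  positive dimension. It is applied with \<open>b\<close> blue and \<open>r\<close> red.
\<close>

lemma (in regular_trisp) removal_unique:
  assumes \<sigma>: "\<sigma> \<in> simplices T n" and b: "b \<in> vertices T n \<sigma>" and r: "r \<in> vertices T n \<sigma>"
    and "b \<noteq> r"
  shows "\<exists>m. n = Suc m \<and> (\<exists>!\<tau>. \<tau> \<in> simplices T m \<and>
           (\<exists>i\<le>Suc m. vertex T (Suc m) i \<sigma> = r \<and> bdry T m i \<sigma> = \<tau>))"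
proof -
  obtain j k where jk: "j \<le> n" "b = vertex T n j \<sigma>" "k \<le> n" "r = vertex T n k \<sigma>"
    using b r unfolding vertices_def by blast
  have "n \<noteq> 0"
  proof
    assume "n = 0"
    then show False using jk \<open>b \<noteq> r\<close> by simp
  qed
  then obtain m where m: "n = Suc m" by (cases n) auto
  have pos: "i = k" if "i \<le> Suc m" "vertex T (Suc m) i \<sigma> = r" for i
    using distinct_vertices[OF \<sigma>] that jk(3,4) m by (auto dest: inj_onD)
  have "\<exists>!\<tau>. \<tau> \<in> simplices T m \<and>
           (\<exists>i\<le>Suc m. vertex T (Suc m) i \<sigma> = r \<and> bdry T m i \<sigma> = \<tau>)"
  proof (rule ex1I[of _ "bdry T m k \<sigma>"])
    show "bdry T m k \<sigma> \<in> simplices T m \<and>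
        (\<exists>i\<le>Suc m. vertex T (Suc m) i \<sigma> = r \<and> bdry T m i \<sigma> = bdry T m k \<sigma>)"
      using bdry_closed \<sigma> jk(3,4) m by blast
  qed (use pos in blast)
  then show ?thesis using m by blast
qed

theorem proposition7:
  fixes G :: "('g, 'm) monoid_scheme" and T :: "'a trisp_data"
    and act :: "nat \<Rightarrow> 'g \<Rightarrow> 'a \<Rightarrow> 'a"
    and B R :: "'a set" and \<phi> :: "'a \<Rightarrow> 'a"
  assumes "group G" and "finite (carrier G)"
    and "regular_trisp T" and "finite_trisp T"
    and "trisp_action G act T" and "condition_R G act T"
    and "trisp_closure_map T B R \<phi>"
    and equivariant: "\<And>g b. \<lbrakk>g \<in> carrier G; b \<in> B\<rbrakk> \<Longrightarrow> \<phi> (act 0 g b) = act 0 g (\<phi> b)"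
    and B_closed: "\<And>g b. \<lbrakk>g \<in> carrier G; b \<in> B\<rbrakk> \<Longrightarrow> act 0 g b \<in> B"
    and R_closed: "\<And>g r. \<lbrakk>g \<in> carrier G; r \<in> R\<rbrakk> \<Longrightarrow> act 0 g r \<in> R"
  shows "(\<forall>b\<in>B. quotient_map G act \<phi> (orbit G (act 0) b) = orbit G (act 0) (\<phi> b)) \<and>
    trisp_closure_map (quotient_trisp G act T)
      {orbit G (act 0) b | b. b \<in> B} {orbit G (act 0) r | r. r \<in> R} (quotient_map G act \<phi>)"
proof -
  interpret act: trisp_action G act T by fact
  interpret C: trisp_closure_map T B R \<phi> by fact
  interpret quotient: regular_trisp "quotient_trisp G act T"
    using act.regular_quotient \<open>condition_R G act T\<close> \<open>regular_trisp T\<close> by blast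
  let ?Orb = "\<lambda>n \<sigma>. orbit G (act n) \<sigma>" and ?Q = "quotient_trisp G act T"
  let ?B = "{?Orb 0 b | b. b \<in> B}" and ?R = "{?Orb 0 r | r. r \<in> R}"
  let ?\<phi> = "quotient_map G act \<phi>"
  have B: "B \<subseteq> simplices T 0" and R: "R \<subseteq> simplices T 0" using C.partition(1) by auto
  have \<phi>_orbit: "?\<phi> (?Orb 0 b) = ?Orb 0 (\<phi> b)" if "b \<in> B" for b
    using act.quotient_map_orbit[OF B _ that equivariant] C.maps R by blast
  have blue: "?Orb 0 v \<in> ?B \<longleftrightarrow> v \<in> B" if "v \<in> simplices T 0" for v
    using act.blue_orbit_iff[OF B B_closed that] .
  have disjoint: "?B \<inter> ?R = {}"
    using blue C.partition(2) R by blast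
  have "trisp_closure_map ?Q ?B ?R ?\<phi>"
  proof
    show "?B \<union> ?R = simplices ?Q 0"
      unfolding act.simplices_quotient C.partition(1)[symmetric] by blast
    show "?B \<inter> ?R = {}" by (rule disjoint)
    show "?\<phi> \<in> ?B \<rightarrow> ?R" using \<phi>_orbit C.maps by auto
    fix n S c assume "S \<in> simplices ?Q n" and min': "is_min_blue ?Q ?B n S c"
    then obtain \<sigma> where \<sigma>: "\<sigma> \<in> simplices T n" and S: "S = ?Orb n \<sigma>"
      unfolding act.simplices_quotient by blast
    obtain b where min: "is_min_blue T B n \<sigma> b" and c: "c = ?Orb 0 b"
      using act.is_min_blue_quotient[OF B _ \<sigma> min'[unfolded S]] B_closed by blast
    have b: "b \<in> B" using min unfolding is_min_blue_def by blast
    have \<phi>c: "?\<phi> c = ?Orb 0 (\<phi> b)" using \<phi>_orbit[OF b] c by simp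
    show "?\<phi> c \<in> vertices ?Q n S \<and>
          (\<exists>m. n = Suc m \<and> (\<exists>!\<tau>. \<tau> \<in> simplices ?Q m \<and>
            (\<exists>i\<le>Suc m. vertex ?Q (Suc m) i S = ?\<phi> c \<and> bdry ?Q m i S = \<tau>))) \<or>
        ?\<phi> c \<notin> vertices ?Q n S \<and>
          (\<exists>!\<tau>. \<tau> \<in> simplices ?Q (Suc n) \<and> ?\<phi> c \<in> vertices ?Q (Suc n) \<tau> \<and>
            (\<exists>i\<le>Suc n. bdry ?Q n i \<tau> = S))"
    proof (cases "?\<phi> c \<in> vertices ?Q n S")
      case True
      have "c \<in> vertices ?Q n S" "c \<in> ?B"
        using min' unfolding is_min_blue_def vertices_def by blast+
      have "\<phi> b \<in> simplices T 0" "\<phi> b \<notin> B" using C.maps C.partition b by auto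
      then have "?Orb 0 (\<phi> b) \<notin> ?B" by (simp only: blue not_False_eq_True)
      then have "c \<noteq> ?\<phi> c" unfolding \<phi>c using \<open>c \<in> ?B\<close> by metis
      then show ?thesis
        using quotient.removal_unique[OF \<open>S \<in> simplices ?Q n\<close> \<open>c \<in> vertices ?Q n S\<close> True] True
        by blast
    next
      case False
      then have new: "?Orb 0 (\<phi> b) \<notin> ?Orb 0 ` vertices T n \<sigma>"
        using \<phi>c S act.vertices_quotient[OF \<sigma>] by simp
      then have "\<phi> b \<notin> vertices T n \<sigma>" by blast
      then have ex1: "\<exists>!\<tau>. \<tau> \<in> simplices T (Suc n) \<and> \<phi> b \<in> vertices T (Suc n) \<tau> \<and>
          (\<exists>i\<le>Suc n. bdry T n i \<tau> = \<sigma>)"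
        using C.closure[OF \<sigma> min] by blast
      then obtain \<tau> i where \<tau>: "\<tau> \<in> simplices T (Suc n)" "\<phi> b \<in> vertices T (Suc n) \<tau>"
        and i: "i \<le> Suc n" "bdry T n i \<tau> = \<sigma>" by blast
      have "\<exists>!U. U \<in> simplices ?Q (Suc n) \<and> ?\<phi> c \<in> vertices ?Q (Suc n) U \<and>
          (\<exists>i\<le>Suc n. bdry ?Q n i U = S)"
      proof (rule ex1I[of _ "?Orb (Suc n) \<tau>"])
        have "?Orb (Suc n) \<tau> \<in> simplices ?Q (Suc n)"
          using \<tau>(1) unfolding act.simplices_quotient by blast
        moreover have "?\<phi> c \<in> vertices ?Q (Suc n) (?Orb (Suc n) \<tau>)"
          using \<phi>c \<tau> act.vertices_quotient[OF \<tau>(1)] by simp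
        moreover have "bdry ?Q n i (?Orb (Suc n) \<tau>) = S"
          using act.bdry_quotient_trisp[OF \<tau>(1) i(1)] i(2) S by simp
        ultimately show "?Orb (Suc n) \<tau> \<in> simplices ?Q (Suc n) \<and>
            ?\<phi> c \<in> vertices ?Q (Suc n) (?Orb (Suc n) \<tau>) \<and>
            (\<exists>i\<le>Suc n. bdry ?Q n i (?Orb (Suc n) \<tau>) = S)"
          using i(1) by blast
      next
        fix U assume U: "U \<in> simplices ?Q (Suc n) \<and> ?\<phi> c \<in> vertices ?Q (Suc n) U \<and>
            (\<exists>i\<le>Suc n. bdry ?Q n i U = S)"
        then obtain j where j: "j \<le> Suc n" "bdry ?Q n j U = ?Orb n \<sigma>" using S by blast
        \<comment> \<open>A representative over the same \<open>\<sigma>\<close> can be compared with \<open>\<tau>\<close> inside \<open>T\<close>.\<close>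
        obtain \<tau>' where \<tau>': "\<tau>' \<in> simplices T (Suc n)" "U = ?Orb (Suc n) \<tau>'" "bdry T n j \<tau>' = \<sigma>"
          using act.coface_representative[OF \<sigma> _ j] U by blast
        have "?Orb 0 (\<phi> b) \<in> ?Orb 0 ` vertices T (Suc n) \<tau>'"
          using U \<phi>c \<tau>'(2) act.vertices_quotient[OF \<tau>'(1)] by simp
        then have "\<phi> b \<in> vertices T (Suc n) \<tau>'"
          using act.red_coface_contains_image[OF \<open>condition_R G act T\<close> \<open>trisp_closure_map T B R \<phi>\<close>
              R_closed \<tau>'(1) j(1)] \<tau>'(3) min new by simp
        then have "\<tau>' = \<tau>" using ex1 \<tau> i \<tau>' j(1) by blast
        then show "U = ?Orb (Suc n) \<tau>" using \<tau>'(2) by simp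
      qed
      then show ?thesis using False by blast
    qed
  qed
  then show ?thesis using \<phi>_orbit by blast
qed

end
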